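(* Let $k\ge1$, let $\mathbf n=(n_1,\dots,n_k)$ be positive integers with $n=\sum_{i=1}^k n_i$, and let $q\ge 0$, $m\ge0$ be integers. Let $Q(\mathbf n;q;m)$ be the number of words containing exactly $n_i$ copies of letter $i$ ($1\le i\le k$) such that $l_m\le q$, where $l_m$ is the length of the $(m+1)$-th longest run when the lengths of all runs (of all letters) are sorted together. In the sums below write $p=\sum_{i=1}^k p_i$ and $j=\sum_{i=1}^k j_i$. (a) If $q>0$, then $$Q(\mathbf n;q;m)=(-1)^{n+m}\sum_{p_1=1}^{n_1}\cdots\sum_{p_k=1}^{n_k}(-1)^p\frac{p!}{p_1!\cdots p_k!}\sum_{j_1,\dots,j_k}(-1)^{j(q+1)}\binom{j-1}{m}\prod_{i=1}^k\binom{n_i-qj_i-1}{p_i-1}\binom{p_i}{n_i-qj_i-j_i},$$ where for each $i$ the index $j_i$ runs over the integers with $\lceil (n_i-p_i)/(q+1)\rceil\le j_i\le\lfloor (n_i-p_i)/q\rfloor$. (b) If $q=0$ and $m\ge n$, then $Q(\mathbf n;0;m)=\dfrac{n!}{n_1!\cdots n_k!}$. (c) If $q=0$ and $m<n$, then $$Q(\mathbf n;0;m)=(-1)^m\sum_{p_1=1}^{n_1}\cdots\sum_{p_k=1}^{n_k}(-1)^p\binom{n-p-1}{m-p}\frac{p!}{p_1!\cdots p_k!}\prod_{i=1}^k\binom{n_i-1}{p_i-1}.$$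
   Context: Words are finite linear sequences over the alphabet $\{1,\dots,k\}$; copies of the same letter are indistinguishable. A run is a maximal block of consecutive equal letters. If a word has $r$ runs in total, the lengths of all its runs, regardless of letter, are sorted as $l_0\ge l_1\ge\cdots\ge l_{r-1}$, and $l_i=0$ for $i\ge r$. Thus $l_m\le q$ means that at most $m$ runs of the word have length greater than $q$. Convention for binomial coefficients $\binom ab$ with integers $a,b$: $\binom ab=0$ if $b<0$, and $\binom ab=a(a-1)\cdots(a-b+1)/b!$ if $b\ge0$ (so $\binom{-1}{b}=(-1)^b$ for $b\ge 0$). An empty sum is $0$. *)

theory Defs
  imports Complex_Main "HOL-Library.FuncSet"
begin

function runs :: "'a list \<Rightarrow> 'a list list" where
  "runs [] = []"
| "runs (x # xs) = (x # takeWhile (\<lambda>y. y = x) xs) # runs (dropWhile (\<lambda>y. y = x) xs)"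
  by pat_completeness auto
termination
  by (relation "measure length") (auto simp: less_Suc_eq_le length_dropWhile_le)

text \<open>The next four facts confirm that the members of \<open>runs w\<close> are the maximal blocks of
  consecutive equal letters of \<open>w\<close>, from left to right.\<close>

lemma concat_runs: "concat (runs w) = w"
  by (induction w rule: runs.induct) simp_all

lemma runs_nonempty: "r \<in> set (runs w) \<Longrightarrow> r \<noteq> []"
  by (induction w rule: runs.induct) auto

lemma runs_constant:
  "r \<in> set (runs w) \<Longrightarrow> x \<in> set r \<Longrightarrow> y \<in> set r \<Longrightarrow> x = y"
  by (induction w rule: runs.induct) (auto dest!: set_takeWhileD)

lemma runs_adjacent_distinct: "successively (\<lambda>r s. last r \<noteq> hd s) (runs w)"
proof (induction w rule: runs.induct)
  case (2 x xs)
  have "last (x # takeWhile (\<lambda>y. y = x) xs) \<in> set (x # takeWhile (\<lambda>y. y = x) xs)"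
    by (rule last_in_set) simp
  then have "last (x # takeWhile (\<lambda>y. y = x) xs) = x"
    by (auto dest: set_takeWhileD)
  moreover have "y \<noteq> x" if "dropWhile (\<lambda>y. y = x) xs = y # ys" for y ys
    using hd_dropWhile[of "\<lambda>y. y = x" xs] that by simp
  ultimately show ?case
    using 2 by (cases "dropWhile (\<lambda>y. y = x) xs") (simp_all del: dropWhile_eq_Nil_conv)
qed simp

definition run_length :: "'a list \<Rightarrow> nat \<Rightarrow> nat" where
  "run_length w i =
     (let ls = rev (sort (map length (runs w))) in if i < length ls then ls ! i else 0)"

definition words :: "nat \<Rightarrow> (nat \<Rightarrow> nat) \<Rightarrow> nat list set" where
  "words k n = {w. set w \<subseteq> {1..k} \<and> (\<forall>i\<in>{1..k}. count_list w i = n i)}"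

definition Q :: "nat \<Rightarrow> (nat \<Rightarrow> nat) \<Rightarrow> nat \<Rightarrow> nat \<Rightarrow> nat" where
  "Q k n q m = card {w \<in> words k n. run_length w m \<le> q}"

text \<open>\<open>Q\<close> counts a finite set, so \<open>card\<close> is not degenerate here.\<close>

lemma finite_words: "finite (words k n)"
proof (rule finite_subset)
  show "words k n \<subseteq> {w. set w \<subseteq> {1..k} \<and> length w = (\<Sum>i\<in>{1..k}. n i)}"
  proof
    fix w assume "w \<in> words k n"
    then have sub: "set w \<subseteq> {1..k}" and cnt: "\<And>i. i \<in> {1..k} \<Longrightarrow> count_list w i = n i"
      by (simp_all add: words_def)
    have "length w = (\<Sum>i\<in>{1..k}. count_list w i)"
      by (rule sum_count_set[OF sub, symmetric]) simp
    also have "\<dots> = (\<Sum>i\<in>{1..k}. n i)"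
      by (rule sum.cong) (simp_all only: cnt)
    finally show "w \<in> {w. set w \<subseteq> {1..k} \<and> length w = (\<Sum>i\<in>{1..k}. n i)}"
      using sub by simp
  qed
  show "finite {w. set w \<subseteq> {1..k} \<and> length w = (\<Sum>i\<in>{1..k}. n i)}"
    by (rule finite_lists_length_eq) simp
qed

text \<open>Binomial coefficient with integer entries: zero for a negative lower entry, and the
  falling factorial quotient (so possibly nonzero when the upper entry is negative) otherwise.\<close>

definition ibinom :: "int \<Rightarrow> int \<Rightarrow> real" where
  "ibinom a b = (if b < 0 then 0 else real_of_int a gchoose nat b)"

definition multinom :: "nat \<Rightarrow> (nat \<Rightarrow> nat) \<Rightarrow> real" where
  "multinom k p = fact (\<Sum>i\<in>{1..k}. p i) / (\<Prod>i\<in>{1..k}. fact (p i))"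

end

theory Submission
  imports Defs "HOL-Computational_Algebra.Polynomial" "HOL-Computational_Algebra.Formal_Power_Series"
begin

unbundle fps_syntax

text \<open>
  Give a run of length \<open>l\<close> the weight \<open>v\<^sub>l\<close>, put \<open>V = 1 + \<Sum>\<^sub>l v\<^sub>l X\<^sup>l\<close> and \<open>B = 1 - 1/V\<close>. Since
  \<open>V = 1/(1 - B)\<close>, the weight of a run is the total \<open>B\<close>-weight of its compositions into blocks, so
  summing run weights over words is the same as summing \<open>B\<close>-weights over words cut into constant
  blocks in which neighbours may carry the same letter. With \<open>p\<^sub>i\<close> blocks of letter \<open>i\<close> this gives
  \<open>\<Sum>\<^sub>p (p!/(p\<^sub>1! \<dots> p\<^sub>k!)) \<Prod>\<^sub>i [X\<^bsup>n\<^sub>i\<^esup>] B\<^bsup>p\<^sub>i\<^esup>\<close>.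

  Weighting the runs longer than \<open>q\<close> by \<open>t\<close> yields
  \<open>B = X (1 - (1-t) X\<^sup>q) / (1 - (1-t) X\<^bsup>q+1\<^esup>)\<close>. Expanding \<open>B\<^bsup>p\<^sub>i\<^esup>\<close> writes the generating polynomial of the
  number of long runs in terms of \<open>t\<^sup>a (1-t)\<^sup>b\<close>, and adding up its coefficients of degree at most \<open>m\<close>
  produces the remaining binomial coefficient.
\<close>

section \<open>Run weights and cutting off the first block\<close>

definition run_weight :: "real fps \<Rightarrow> 'a list \<Rightarrow> real" where
  "run_weight V w = (\<Prod>r\<leftarrow>runs w. V $ length r)"

text \<open>The condition on \<open>ys\<close> makes the prefix a complete run. For
  \<open>l = 0\<close> the claim rests on \<open>V $ 0 = 1\<close>; this case occurs when a block
  uses up the whole leading run.\<close>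

lemma run_weight_replicate_append:
  assumes "V $ 0 = 1" "ys = [] \<or> hd ys \<noteq> x"
  shows "run_weight V (replicate l x @ ys) = V $ l * run_weight V ys"
proof (cases l)
  case (Suc l')
  have "takeWhile (\<lambda>y. y = x) (replicate l' x @ ys) = replicate l' x"
    using assms(2) by (cases ys) (auto simp: takeWhile_append)
  moreover have "dropWhile (\<lambda>y. y = x) (replicate l' x @ ys) = ys"
    using assms(2) by (cases ys) (auto simp: dropWhile_append)
  ultimately show ?thesis using Suc by (simp add: run_weight_def)
qed (use assms in simp)

text \<open>With \<open>L\<close> the length of the leading run, this is the coefficient of
  \<open>X^L\<close> in \<open>B * V = V - 1\<close>, times the weight of what follows the run:
  cutting off a block of length \<open>l\<close> leaves the factor
  \<open>V $ (L - l)\<close>.\<close>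

lemma run_weight_recurrence:
  assumes "V $ 0 = 1" "B * V = V - 1" "w \<noteq> []"
  shows "run_weight V w =
    (\<Sum>l\<in>{1..length (takeWhile (\<lambda>y. y = hd w) w)}. B $ l * run_weight V (drop l w))"
proof -
  define L where "L = length (takeWhile (\<lambda>y. y = hd w) w)"
  define ys where "ys = dropWhile (\<lambda>y. y = hd w) w"
  have ys: "ys = [] \<or> hd ys \<noteq> hd w"
    unfolding ys_def using hd_dropWhile[of "\<lambda>y. y = hd w" w] by blast
  have "takeWhile (\<lambda>y. y = hd w) w = replicate L (hd w)"
    unfolding L_def by (intro replicate_eqI) (auto dest: set_takeWhileD)
  then have w: "w = replicate L (hd w) @ ys"
    unfolding ys_def using takeWhile_dropWhile_id[of "\<lambda>y. y = hd w" w] by simp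
  have "L \<ge> 1" using assms(3) by (cases w) (auto simp: L_def)
  have "B $ 0 = 0"
    using arg_cong[OF assms(2), of "\<lambda>f. f $ 0"] assms(1) by simp
  have "(\<Sum>l\<in>{1..L}. B $ l * run_weight V (drop l w)) =
        (\<Sum>l\<in>{1..L}. B $ l * V $ (L - l)) * run_weight V ys"
  proof (subst sum_distrib_right, rule sum.cong)
    fix l assume "l \<in> {1..L}"
    then have "drop l w = replicate (L - l) (hd w) @ ys"
      by (subst w) simp
    then show "B $ l * run_weight V (drop l w) = B $ l * V $ (L - l) * run_weight V ys"
      by (simp add: run_weight_replicate_append[OF assms(1) ys])
  qed simp
  also have "(\<Sum>l\<in>{1..L}. B $ l * V $ (L - l)) = (B * V) $ L"
    using \<open>B $ 0 = 0\<close> by (simp add: fps_mult_nth sum.atLeast_Suc_atMost)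
  also have "\<dots> = V $ L" using assms(2) \<open>L \<ge> 1\<close> by simp
  also have "V $ L * run_weight V ys = run_weight V w"
    using run_weight_replicate_append[OF assms(1) ys, of L] w by simp
  finally show ?thesis by (simp add: L_def)
qed

lemma replicate_append_mem_words:
  assumes "i \<in> {1..k}" "l \<le> n i"
  shows "replicate l i @ w \<in> words k n \<longleftrightarrow> w \<in> words k (n(i := n i - l))"
proof -
  have "count_list (replicate l i) x = (if x = i then l else 0)" for x
    by (induction l) auto
  then show ?thesis using assms by (auto simp: words_def)
qed

lemma replicate_prefix_le_count:
  assumes "replicate l i @ w \<in> words k n" "l > 0"
  shows "i \<in> {1..k}" "l \<le> n i"
proof -
  have c: "count_list (replicate l i) x = (if x = i then l else 0)" for x
    by (induction l) auto
  show i: "i \<in> {1..k}" using assms by (auto simp: words_def)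
  then show "l \<le> n i" using assms c by (force simp: words_def)
qed

text \<open>Sorts by the letter \<open>i\<close> and the length \<open>l\<close> of the first block.
  The rest of the word may again begin with \<open>i\<close>, since a block need not fill its
  run.\<close>

lemma words_weight_recurrence:
  assumes "V $ 0 = 1" "B * V = V - 1" "\<exists>i\<in>{1..k}. n i > 0"
  shows "(\<Sum>w\<in>words k n. run_weight V w) =
    (\<Sum>i\<in>{1..k}. \<Sum>l\<in>{1..n i}. B $ l * (\<Sum>w\<in>words k (n(i := n i - l)). run_weight V w))"
proof -
  have "w \<noteq> []" if "w \<in> words k n" for w
    using that assms(3) by (auto simp: words_def)
  then have "(\<Sum>w\<in>words k n. run_weight V w) =
    (\<Sum>w\<in>words k n. \<Sum>l\<in>{1..length (takeWhile (\<lambda>y. y = hd w) w)}. B $ l * run_weight V (drop l w))"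
    by (intro sum.cong refl run_weight_recurrence assms)
  also have "\<dots> = (\<Sum>(w, l)\<in>(SIGMA w:words k n. {1..length (takeWhile (\<lambda>y. y = hd w) w)}).
      B $ l * run_weight V (drop l w))"
    by (rule sum.Sigma) (auto simp: finite_words)
  \<comment> \<open>A word with a cut position corresponds to a letter, a block length and a rest;
    \<open>l \<ge> 1\<close> lets the letter be recovered as the head.\<close>
  also have "\<dots> = (\<Sum>(i, l, w)\<in>(SIGMA i:{1..k}. SIGMA l:{1..n i}. words k (n(i := n i - l))).
      B $ l * run_weight V w)"
  proof (rule sum.reindex_bij_witness[where
        i = "\<lambda>(i, l, w). (replicate l i @ w, l)" and j = "\<lambda>(w, l). (hd w, l, drop l w)"])
    fix a assume "a \<in> (SIGMA w:words k n. {1..length (takeWhile (\<lambda>y. y = hd w) w)})"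
    then obtain w l where a: "a = (w, l)" and w: "w \<in> words k n"
      and l: "1 \<le> l" "l \<le> length (takeWhile (\<lambda>y. y = hd w) w)"
      by auto
    have "take l w = take l (takeWhile (\<lambda>y. y = hd w) w @ dropWhile (\<lambda>y. y = hd w) w)"
      by simp
    also have "\<dots> = take l (takeWhile (\<lambda>y. y = hd w) w)"
      using l by (simp only: take_append) simp
    also have "\<dots> = replicate l (hd w)"
      using l by (intro replicate_eqI) (auto dest!: in_set_takeD set_takeWhileD)
    finally have eq: "replicate l (hd w) @ drop l w = w"
      by (metis append_take_drop_id)
    have *: "hd w \<in> {1..k}" "l \<le> n (hd w)"
      using replicate_prefix_le_count[of l "hd w" "drop l w"] eq w l by auto
    show "(case case a of (w, l) \<Rightarrow> (hd w, l, drop l w) of (i, l, w) \<Rightarrow> (replicate l i @ w, l)) = a"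
      using eq a by simp
    show "(case a of (w, l) \<Rightarrow> (hd w, l, drop l w)) \<in>
        (SIGMA i:{1..k}. SIGMA l:{1..n i}. words k (n(i := n i - l)))"
      using * replicate_append_mem_words[of "hd w" k l n "drop l w"] eq w l a by auto
    show "(case case a of (w, l) \<Rightarrow> (hd w, l, drop l w) of (i, l, w) \<Rightarrow> B $ l * run_weight V w) =
        (case a of (w, l) \<Rightarrow> B $ l * run_weight V (drop l w))"
      using a by simp
  next
    fix b assume "b \<in> (SIGMA i:{1..k}. SIGMA l:{1..n i}. words k (n(i := n i - l)))"
    then obtain i l w where b: "b = (i, l, w)" and
      *: "i \<in> {1..k}" "1 \<le> l" "l \<le> n i" "w \<in> words k (n(i := n i - l))"
      by auto
    then have hd: "hd (replicate l i @ w) = i"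
      by (cases l) auto
    then show "(case case b of (i, l, w) \<Rightarrow> (replicate l i @ w, l) of (w, l) \<Rightarrow> (hd w, l, drop l w)) = b"
      using b by simp
    have "l \<le> length (takeWhile (\<lambda>y. y = i) (replicate l i @ w))"
      by (subst takeWhile_append2) auto
    then show "(case b of (i, l, w) \<Rightarrow> (replicate l i @ w, l)) \<in>
        (SIGMA w:words k n. {1..length (takeWhile (\<lambda>y. y = hd w) w)})"
      using replicate_append_mem_words[of i k l n w] * b hd by simp
  qed
  also have "\<dots> = (\<Sum>i\<in>{1..k}. \<Sum>l\<in>{1..n i}. \<Sum>w\<in>words k (n(i := n i - l)). B $ l * run_weight V w)"
    by (simp add: sum.Sigma finite_words)
  finally show ?thesis by (simp add: sum_distrib_left)
qed

section \<open>Multinomial coefficients and the sum over block counts\<close>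

lemma multinom_cong:
  assumes "\<And>i. i \<in> {1..k} \<Longrightarrow> p i = p' i"
  shows "multinom k p = multinom k p'"
proof -
  have "(\<Sum>i\<in>{1..k}. p i) = (\<Sum>i\<in>{1..k}. p' i)"
       "(\<Prod>i\<in>{1..k}. fact (p i) :: real) = (\<Prod>i\<in>{1..k}. fact (p' i))"
    using assms by (auto intro: sum.cong prod.cong)
  then show ?thesis by (simp add: multinom_def)
qed

text \<open>Each summand is the fraction \<open>p i / P\<close> of \<open>multinom k p\<close>,
  where \<open>P\<close> is the sum of all \<open>p i\<close>, and these fractions add up to 1.
  Combinatorially, \<open>i\<close> is the letter of the first block.\<close>

lemma multinom_recurrence:
  assumes "\<exists>i\<in>{1..k}. p i > 0"
  shows "multinom k p = (\<Sum>i\<in>{i\<in>{1..k}. p i > 0}. multinom k (p(i := p i - 1)))"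
proof -
  define P D where "P = (\<Sum>i\<in>{1..k}. p i)" and "D = (\<Prod>i\<in>{1..k}. fact (p i) :: real)"
  have "D \<noteq> 0" by (simp add: D_def)
  have "P > 0" using assms unfolding P_def by (metis finite_atLeastAtMost gr0I sum_eq_0_iff less_numeral_extra(3))
  have step: "multinom k (p(i := p i - 1)) = fact (P - 1) * real (p i) / D"
    if i: "i \<in> {1..k}" "p i > 0" for i
  proof -
    have "P = p i + (\<Sum>j\<in>{1..k} - {i}. p j)"
      unfolding P_def using i by (simp add: sum.remove)
    moreover have "(\<Sum>j\<in>{1..k}. (p(i := p i - 1)) j) = (p i - 1) + (\<Sum>j\<in>{1..k} - {i}. p j)"
      using i by (subst sum.remove[of _ i]) auto
    ultimately have s: "(\<Sum>j\<in>{1..k}. (p(i := p i - 1)) j) = P - 1" using i by simp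
    have "D = fact (p i) * (\<Prod>j\<in>{1..k} - {i}. fact (p j))"
      unfolding D_def using i by (simp add: prod.remove)
    moreover have "(\<Prod>j\<in>{1..k}. fact ((p(i := p i - 1)) j)) =
        (fact (p i - 1) * (\<Prod>j\<in>{1..k} - {i}. fact (p j)) :: real)"
      using i by (subst prod.remove[of _ i]) auto
    moreover have "fact (p i) = (real (p i) * fact (p i - 1) :: real)"
      using i fact_reduce by blast
    ultimately have "D = real (p i) * (\<Prod>j\<in>{1..k}. fact ((p(i := p i - 1)) j))" by simp
    then show ?thesis unfolding multinom_def s using i \<open>D \<noteq> 0\<close> by simp
  qed
  have "(\<Sum>i\<in>{i\<in>{1..k}. p i > 0}. multinom k (p(i := p i - 1))) =
        (\<Sum>i\<in>{i\<in>{1..k}. p i > 0}. fact (P - 1) * real (p i) / D)"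
    by (rule sum.cong[OF refl], rule step) auto
  also have "\<dots> = (\<Sum>i\<in>{1..k}. fact (P - 1) * real (p i) / D)"
    by (rule sum.mono_neutral_left) auto
  also have "\<dots> = fact (P - 1) * real P / D"
    by (simp add: P_def sum_distrib_left sum_divide_distrib)
  also have "\<dots> = multinom k p"
    using fact_reduce[OF \<open>P > 0\<close>, where 'a = real]
    unfolding multinom_def P_def[symmetric] D_def[symmetric] by (simp add: mult.commute)
  finally show ?thesis by simp
qed

text \<open>All \<open>p i\<close> range up to a common bound so that the index set does not change with \<open>n\<close>; the
  additional terms vanish because \<open>B\<close> has no constant term.\<close>

lemma multinom_sum_recurrence:
  fixes B :: "real fps"
  assumes "B $ 0 = 0" "\<exists>i\<in>{1..k}. n i > 0" "\<forall>i\<in>{1..k}. n i \<le> M"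
  defines "R \<equiv> \<lambda>n. \<Sum>p\<in>(\<Pi>\<^sub>E i\<in>{1..k}. {..M}). multinom k p * (\<Prod>i\<in>{1..k}. (B ^ p i) $ n i)"
  shows "R n = (\<Sum>i\<in>{1..k}. \<Sum>l\<in>{1..n i}. B $ l * R (n(i := n i - l)))"
proof -
  define P where "P = (\<Pi>\<^sub>E i\<in>{1..k}. {..M})"
  define T where "T = (\<lambda>p n. \<Prod>i\<in>{1..k}. (B ^ p i) $ n i)"
  have [simp]: "finite P" unfolding P_def by (intro finite_PiE) auto
  \<comment> \<open>One more block of letter \<open>i\<close>: the sum over its length is the
    convolution for \<open>B * B ^ p i\<close>, whose term at \<open>l = 0\<close> vanishes with
    \<open>B $ 0\<close>.\<close>
  have T_upd: "(\<Sum>l\<in>{1..n i}. B $ l * T p (n(i := n i - l))) = T (p(i := Suc (p i))) n"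
    if i: "i \<in> {1..k}" for i p
  proof -
    define c where "c = (\<Prod>j\<in>{1..k} - {i}. (B ^ p j) $ n j)"
    have "T p (n(i := n i - l)) = (B ^ p i) $ (n i - l) * c" for l
      unfolding T_def c_def using i by (subst prod.remove[of _ i]) (auto intro!: prod.cong)
    moreover have "T (p(i := Suc (p i))) n = (B ^ Suc (p i)) $ n i * c"
      unfolding T_def c_def using i by (subst prod.remove[of _ i]) (auto intro!: prod.cong)
    moreover have "(B ^ Suc (p i)) $ n i = (\<Sum>l\<in>{1..n i}. B $ l * (B ^ p i) $ (n i - l))"
      by (simp add: fps_mult_nth sum.atLeast_Suc_atMost assms(1))
    ultimately show ?thesis by (simp add: sum_distrib_right mult.assoc)
  qed
  \<comment> \<open>The zero tuple is outside the scope of the multinomial recurrence but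
    contributes nothing: some \<open>n i\<close> is positive, and \<open>B ^ 0 = 1\<close> has
    coefficient 0 there.\<close>
  have T0: "T p n = 0" if "\<not> (\<exists>i\<in>{1..k}. p i > 0)" for p
    unfolding T_def using assms(2) that by (intro prod_zero) auto
  have "R n = (\<Sum>p\<in>P. multinom k p * T p n)"
    by (simp add: R_def P_def T_def)
  also have "\<dots> = (\<Sum>p\<in>P. \<Sum>i\<in>{i\<in>{1..k}. p i > 0}. multinom k (p(i := p i - 1)) * T p n)"
  proof (rule sum.cong[OF refl])
    fix p
    show "multinom k p * T p n = (\<Sum>i\<in>{i\<in>{1..k}. p i > 0}. multinom k (p(i := p i - 1)) * T p n)"
      using multinom_recurrence[of k p] T0[of p]
      by (cases "\<exists>i\<in>{1..k}. p i > 0") (simp_all add: sum_distrib_right)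
  qed
  also have "\<dots> = (\<Sum>i\<in>{1..k}. \<Sum>p\<in>{p\<in>P. p i > 0}. multinom k (p(i := p i - 1)) * T p n)"
    by (rule sum.swap_restrict) auto
  also have "\<dots> = (\<Sum>i\<in>{1..k}. \<Sum>p\<in>P. multinom k p * T (p(i := Suc (p i))) n)"
  proof (rule sum.cong[OF refl])
    fix i assume i: "i \<in> {1..k}"
    have "(\<Sum>p\<in>{p\<in>P. p i > 0}. multinom k (p(i := p i - 1)) * T p n) =
          (\<Sum>p\<in>{p\<in>P. p i < M}. multinom k p * T (p(i := Suc (p i))) n)"
    proof (rule sum.reindex_bij_witness[where i = "\<lambda>p. p(i := Suc (p i))" and j = "\<lambda>p. p(i := p i - 1)"])
      fix p assume p: "p \<in> {p\<in>P. p i > 0}"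
      then have "p i \<le> M" using i by (auto simp: P_def)
      moreover have "p(i := p i - 1) \<in> P" unfolding P_def
        using p i \<open>p i \<le> M\<close> by (auto simp: P_def PiE_iff extensional_def intro: order_trans[OF diff_le_self])
      ultimately show "p(i := p i - 1) \<in> {p\<in>P. p i < M}" using p by auto
    next
      fix p assume p: "p \<in> {p\<in>P. p i < M}"
      then have "p(i := Suc (p i)) \<in> P" unfolding P_def
        using i by (auto simp: PiE_iff extensional_def)
      then show "p(i := Suc (p i)) \<in> {p\<in>P. p i > 0}" by simp
    qed auto
    also have "\<dots> = (\<Sum>p\<in>P. multinom k p * T (p(i := Suc (p i))) n)"
    proof (rule sum.mono_neutral_left)
      \<comment> \<open>At the boundary \<open>p i = M\<close> the shifted exponent
        \<open>M + 1\<close> exceeds \<open>n i\<close>, so the power of \<open>B\<close> starts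
        beyond the required coefficient.\<close>
      have "T (p(i := Suc (p i))) n = 0" if "p \<in> P" "\<not> p i < M" for p
      proof -
        have "(B ^ Suc (p i)) $ n i = 0"
        proof (rule startsby_zero_power_prefix[rule_format, OF assms(1)])
          have "n i \<le> M" using assms(3) i by blast
          then show "n i < Suc (p i)" using that(2) by simp
        qed
        then show ?thesis using i unfolding T_def by (intro prod_zero) (auto intro!: bexI[of _ i])
      qed
      then show "\<forall>p\<in>P - {p \<in> P. p i < M}. multinom k p * T (p(i := Suc (p i))) n = 0" by auto
    qed auto
    finally show "(\<Sum>p\<in>{p\<in>P. p i > 0}. multinom k (p(i := p i - 1)) * T p n) =
      (\<Sum>p\<in>P. multinom k p * T (p(i := Suc (p i))) n)" .
  qed
  also have "\<dots> = (\<Sum>i\<in>{1..k}. \<Sum>p\<in>P. \<Sum>l\<in>{1..n i}. multinom k p * (B $ l * T p (n(i := n i - l))))"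
    by (intro sum.cong refl) (simp only: T_upd[symmetric] sum_distrib_left)
  also have "\<dots> = (\<Sum>i\<in>{1..k}. \<Sum>l\<in>{1..n i}. \<Sum>p\<in>P. multinom k p * (B $ l * T p (n(i := n i - l))))"
    by (intro sum.cong refl sum.swap)
  also have "\<dots> = (\<Sum>i\<in>{1..k}. \<Sum>l\<in>{1..n i}. B $ l * R (n(i := n i - l)))"
    by (simp add: R_def P_def T_def sum_distrib_left mult_ac)
  finally show ?thesis .
qed

text \<open>Both sides obey the same first-block recurrence, so induction on the total number of
  letters applies. The bound \<open>M\<close> stays fixed while \<open>n\<close> shrinks.\<close>

lemma sum_run_weight:
  fixes B V :: "real fps"
  assumes V: "V $ 0 = 1" and BV: "B * V = V - 1" and "\<forall>i\<in>{1..k}. n i \<le> M"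
  shows "(\<Sum>w\<in>words k n. run_weight V w) =
    (\<Sum>p\<in>(\<Pi>\<^sub>E i\<in>{1..k}. {..M}). multinom k p * (\<Prod>i\<in>{1..k}. (B ^ p i) $ n i))"
  using assms(3)
proof (induction "\<Sum>i\<in>{1..k}. n i" arbitrary: n rule: less_induct)
  case less
  have B0: "B $ 0 = 0"
    using arg_cong[OF BV, of "\<lambda>f. f $ 0"] V by simp
  show ?case
  proof (cases "\<exists>i\<in>{1..k}. n i > 0")
    case True
    show ?thesis
      unfolding words_weight_recurrence[OF V BV True] multinom_sum_recurrence[OF B0 True less.prems]
    proof (intro sum.cong refl arg_cong2[where f = "(*)"] less.hyps)
      fix i l assume *: "i \<in> {1..k}" "l \<in> {1..n i}"
      then show "(\<Sum>j\<in>{1..k}. (n(i := n i - l)) j) < (\<Sum>j\<in>{1..k}. n j)"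
        by (intro sum_strict_mono_ex1) auto
      have "n i \<le> M" using less.prems * by blast
      then show "\<forall>j\<in>{1..k}. (n(i := n i - l)) j \<le> M" using less.prems by auto
    qed
  next
    case False
    then have n: "n i = 0" if "i \<in> {1..k}" for i using that by auto
    have "words k n = {[]}"
    proof -
      have "w = []" if "w \<in> words k n" for w
        using that n by (cases w) (auto simp: words_def split: if_splits)
      then show ?thesis using n by (auto simp: words_def)
    qed
    \<comment> \<open>With all \<open>n i = 0\<close> only the zero tuple survives, because positive
      powers of \<open>B\<close> have no constant term; its value 1 matches the empty word.\<close>
    moreover have "multinom k p * (\<Prod>i\<in>{1..k}. (B ^ p i) $ n i) =
        (if p = (\<lambda>i\<in>{1..k}. 0) then 1 else 0)" if "p \<in> (\<Pi>\<^sub>E i\<in>{1..k}. {..M})" for p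
    proof (cases "\<exists>i\<in>{1..k}. p i \<noteq> 0")
      case True
      then have "(\<Prod>i\<in>{1..k}. (B ^ p i) $ n i) = 0"
        using n B0 by (intro prod_zero) (auto simp: fps_nth_power_0)
      then show ?thesis using True by auto
    next
      case False
      then have "p = (\<lambda>i\<in>{1..k}. 0)" using that by (auto simp: PiE_iff extensional_def fun_eq_iff)
      then show ?thesis using n by (simp add: multinom_def)
    qed
    ultimately have "(\<Sum>p\<in>(\<Pi>\<^sub>E i\<in>{1..k}. {..M}). multinom k p * (\<Prod>i\<in>{1..k}. (B ^ p i) $ n i)) =
        (\<Sum>p\<in>(\<Pi>\<^sub>E i\<in>{1..k}. {..M}). if p = (\<lambda>i\<in>{1..k}. 0) then 1 else 0)"
      by (intro sum.cong) auto
    also have "\<dots> = 1"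
      by (subst sum.delta) (auto intro: finite_PiE)
    finally show ?thesis using \<open>words k n = {[]}\<close> by (simp add: run_weight_def)
  qed
qed

section \<open>Long runs and the threshold series\<close>

text \<open>In a weakly decreasing list the entries above \<open>q\<close> form an initial segment,
  so there are at most \<open>m\<close> of them exactly if position \<open>m\<close> lies outside
  it. The default 0 past the end never exceeds \<open>q\<close>.\<close>

lemma length_filter_greater_le_iff:
  fixes ls :: "nat list"
  assumes "sorted_wrt (\<ge>) ls"
  shows "length (filter (\<lambda>l. q < l) ls) \<le> m \<longleftrightarrow> (if m < length ls then ls ! m else 0) \<le> q"
  using assms
proof (induction ls arbitrary: m)
  case (Cons x ls)
  show ?case
  proof (cases "x \<le> q")
    case True
    then have small: "\<And>y. y \<in> set (x # ls) \<Longrightarrow> y \<le> q" using Cons.prems by force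
    then have "filter (\<lambda>l. q < l) (x # ls) = []" by (auto simp: filter_empty_conv not_less)
    moreover have "(if m < length (x # ls) then (x # ls) ! m else 0) \<le> q"
      using small nth_mem[of m "x # ls"] by auto
    ultimately show ?thesis by simp
  next
    case False
    then show ?thesis using Cons by (cases m) auto
  qed
qed simp

text \<open>Trades the sorted run lengths for a count of long runs; \<open>t\<close> to the power of
  this count is a product over the runs, hence a run weight.\<close>

lemma run_length_le_iff:
  "run_length w m \<le> q \<longleftrightarrow> length (filter (\<lambda>r. q < length r) (runs w)) \<le> m"
proof -
  define ls where "ls = rev (sort (map length (runs w)))"
  have "sorted_wrt (\<ge>) ls" by (simp add: ls_def sorted_wrt_rev)
  moreover have "length (filter (\<lambda>l. q < l) ls) = length (filter (\<lambda>r. q < length r) (runs w))"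
    by (simp add: ls_def rev_filter[symmetric] filter_sort filter_map comp_def)
  ultimately show ?thesis
    using length_filter_greater_le_iff[of ls q m] by (simp add: run_length_def ls_def Let_def)
qed

text \<open>The coefficient of index 0 is 1: this is the series \<open>V\<close>, constant term included.\<close>

definition threshold_fps :: "nat \<Rightarrow> real \<Rightarrow> real fps" where
  "threshold_fps q t = Abs_fps (\<lambda>l. if l \<le> q then 1 else t)"

definition block_fps :: "nat \<Rightarrow> real \<Rightarrow> real fps" where
  "block_fps q t = fps_X * (1 - fps_const (1 - t) * fps_X ^ q) *
     inverse (1 - fps_const (1 - t) * fps_X ^ Suc q)"

lemma run_weight_threshold_fps:
  "run_weight (threshold_fps q t) w = t ^ length (filter (\<lambda>r. q < length r) (runs w))"
proof -
  have "(\<Prod>r\<leftarrow>rs. threshold_fps q t $ length r) = t ^ length (filter (\<lambda>r. q < length r) rs)"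
    for rs :: "'a list list"
    by (induction rs) (auto simp: threshold_fps_def)
  then show ?thesis by (simp add: run_weight_def)
qed

text \<open>Multiplication by \<open>1 - fps_X\<close> turns the threshold series into the
  polynomial \<open>E\<close>, which is the denominator of \<open>block_fps\<close>, so both sides
  become the same polynomial. The factor cancels because real power series have no zero
  divisors.\<close>

lemma threshold_block_fps:
  "block_fps q t * threshold_fps q t = threshold_fps q t - 1"
proof -
  define E where "E = 1 - fps_const (1 - t) * fps_X ^ Suc q"
  have V: "(1 - fps_X) * threshold_fps q t = E"
  proof (rule fps_ext)
    fix n show "((1 - fps_X) * threshold_fps q t) $ n = E $ n"
      by (cases n) (auto simp: E_def threshold_fps_def left_diff_distrib fps_X_power_nth simp del: power_Suc)
  qed
  have "E $ 0 \<noteq> 0" by (simp add: E_def)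
  then have E: "inverse E * E = 1" by (rule inverse_mult_eq_1)
  have "(1 - fps_X) * (block_fps q t * threshold_fps q t) =
      fps_X * (1 - fps_const (1 - t) * fps_X ^ q) * (inverse E * ((1 - fps_X) * threshold_fps q t))"
    by (simp add: block_fps_def E_def mult_ac)
  also have "\<dots> = fps_X * (1 - fps_const (1 - t) * fps_X ^ q)"
    by (simp add: V E)
  also have "\<dots> = E - (1 - fps_X)"
    by (simp add: E_def algebra_simps)
  also have "\<dots> = (1 - fps_X) * (threshold_fps q t - 1)"
    by (simp add: V right_diff_distrib)
  finally have "(1 - fps_X :: real fps) * (block_fps q t * threshold_fps q t - (threshold_fps q t - 1)) = 0"
    by (simp add: right_diff_distrib)
  moreover have "(1 - fps_X :: real fps) \<noteq> 0"
    by (metis diff_zero fps_nonzeroI fps_one_nth fps_sub_nth fps_X_nth zero_neq_one)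
  ultimately show ?thesis by simp
qed

section \<open>Coefficients of powers of the block series\<close>

lemma fps_nth_compose_X_power:
  fixes f :: "'a :: comm_ring_1 fps"
  assumes "d > 0"
  shows "(f oo fps_X ^ d) $ n = (if d dvd n then f $ (n div d) else 0)"
proof -
  have "(f oo fps_X ^ d) $ n = (\<Sum>i=0..n. if n = d * i then f $ i else 0)"
    by (auto simp: fps_compose_nth power_mult[symmetric] intro!: sum.cong)
  also have "\<dots> = (if d dvd n then f $ (n div d) else 0)"
  proof (cases "d dvd n")
    case True
    then have "(\<Sum>i=0..n. if n = d * i then f $ i else 0) = (\<Sum>i=0..n. if i = n div d then f $ i else 0)"
      using assms by (intro sum.cong) auto
    then show ?thesis using True by simp
  qed (auto intro!: sum.neutral)
  finally show ?thesis .
qed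

text \<open>This is the negative binomial series for \<open>(1 - v X)^(-p)\<close> with
  \<open>fps_X ^ d\<close> substituted for \<open>X\<close>.\<close>

lemma inverse_one_minus_const_fps_X_power_power_nth:
  fixes v :: real
  assumes "p > 0" "d > 0"
  shows "inverse ((1 - fps_const v * fps_X ^ d) ^ p) $ n =
    (if d dvd n then real ((p + n div d - 1) choose (n div d)) * v ^ (n div d) else 0)"
proof -
  have X0: "(fps_X ^ d :: real fps) $ 0 = 0" using assms by (simp add: fps_X_power_nth)
  have "(1 - fps_const v * fps_X ^ d) ^ p = (1 - fps_const v * fps_X) ^ p oo fps_X ^ d"
    using X0 by (simp add: fps_compose_power[symmetric] fps_compose_sub_distrib fps_compose_mult_distrib)
  then have "inverse ((1 - fps_const v * fps_X ^ d) ^ p) = inverse ((1 - fps_const v * fps_X) ^ p) oo fps_X ^ d"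
    using X0 by (simp add: fps_inverse_compose fps_nth_power_0)
  then show ?thesis
    by (simp add: fps_nth_compose_X_power[OF assms(2)] one_minus_const_fps_X_neg_power'[OF assms(1)])
qed

lemma ibinom_of_nat: "ibinom (int a) (int b) = real (a choose b)"
  by (simp add: ibinom_def binomial_gbinomial)

text \<open>The index \<open>a\<close> comes from the binomial theorem for the numerator; the
  negative binomial series of the denominator supplies a second index \<open>b\<close>. The equation
  \<open>n = p + q * a + Suc q * b\<close> fixes \<open>b\<close>: the \<open>if\<close> tests its
  solvability and the \<open>div\<close> solves it.\<close>

lemma block_fps_power_nth_expand:
  assumes "p > 0"
  shows "(block_fps q t ^ p) $ n = (\<Sum>a\<le>p. if p + q * a \<le> n \<and> Suc q dvd n - (p + q * a)
     then real (p choose a) * (t - 1) ^ a *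
       (real ((p + (n - (p + q * a)) div Suc q - 1) choose ((n - (p + q * a)) div Suc q)) *
        (1 - t) ^ ((n - (p + q * a)) div Suc q)) else 0)"
proof -
  define G where "G = inverse ((1 - fps_const (1 - t) * fps_X ^ Suc q) ^ p)"
  have "(1 - fps_const (1 - t) * fps_X ^ q) ^ p = (fps_const (t - 1) * fps_X ^ q + 1) ^ p"
    by (metis (no_types) add.commute diff_conv_add_uminus fps_const_neg minus_diff_eq mult_minus_left)
  also have "\<dots> = (\<Sum>a\<le>p. fps_const (real (p choose a) * (t - 1) ^ a) * fps_X ^ (q * a))"
    by (simp add: binomial_ring power_mult_distrib power_mult fps_of_nat[symmetric] mult.assoc
        flip: fps_const_mult fps_const_power)
  finally have binomial: "(1 - fps_const (1 - t) * fps_X ^ q) ^ p = \<dots>" .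
  have "block_fps q t ^ p = fps_X ^ p * (1 - fps_const (1 - t) * fps_X ^ q) ^ p * G"
    by (simp only: block_fps_def G_def power_mult_distrib fps_inverse_power)
  also have "\<dots> =
      (\<Sum>a\<le>p. fps_const (real (p choose a) * (t - 1) ^ a) * (fps_X ^ (p + q * a) * G))"
    unfolding binomial by (simp add: sum_distrib_left sum_distrib_right power_add mult_ac)
  finally have "block_fps q t ^ p = \<dots>" .
  then have "(block_fps q t ^ p) $ n =
      (\<Sum>a\<le>p. real (p choose a) * (t - 1) ^ a * (if n < p + q * a then 0 else G $ (n - (p + q * a))))"
    by (simp add: fps_sum_nth fps_X_power_mult_nth)
  also have "\<dots> = (\<Sum>a\<le>p. if p + q * a \<le> n \<and> Suc q dvd n - (p + q * a)
     then real (p choose a) * (t - 1) ^ a *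
       (real ((p + (n - (p + q * a)) div Suc q - 1) choose ((n - (p + q * a)) div Suc q)) *
        (1 - t) ^ ((n - (p + q * a)) div Suc q)) else 0)"
    unfolding G_def inverse_one_minus_const_fps_X_power_power_nth[OF assms zero_less_Suc]
    by (intro sum.cong refl) (simp add: not_less)
  finally show ?thesis .
qed

text \<open>For \<open>q = 0\<close> every \<open>a\<close> leaves the same exponent for the
  denominator, so the sum over \<open>a\<close> separates and collapses to
  \<open>((t - 1) + 1) ^ p\<close>.\<close>

lemma block_fps_0_power_nth:
  assumes "1 \<le> p" "p \<le> n"
  shows "(block_fps 0 t ^ p) $ n = real ((n - 1) choose (p - 1)) * t ^ p * (1 - t) ^ (n - p)"
proof -
  have "(block_fps 0 t ^ p) $ n =
      (\<Sum>a\<le>p. real (p choose a) * (t - 1) ^ a) * (real ((n - 1) choose (n - p)) * (1 - t) ^ (n - p))"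
    using assms by (simp add: block_fps_power_nth_expand sum_distrib_right)
  also have "(\<Sum>a\<le>p. real (p choose a) * (t - 1) ^ a) = t ^ p"
    using binomial_ring[of "t - 1" 1 p] by simp
  also have "(n - 1) choose (n - p) = (n - 1) choose (p - 1)"
    using assms by (subst binomial_symmetric) (auto simp: le_diff_conv)
  finally show ?thesis by (simp add: mult_ac)
qed

text \<open>Passes from pairs \<open>(a, b)\<close> with \<open>n - p = q * a + Suc q * b\<close> to
  \<open>j = a + b\<close>, the total exponent of \<open>1 - t\<close>. Conversely
  \<open>a = (q + 1) * j - (n - p)\<close> and \<open>b = (n - p) - q * j\<close>, so
  \<open>j\<close> determines the pair.\<close>

lemma block_fps_power_nth:
  assumes "q > 0" "1 \<le> p" "p \<le> n"
  shows "(block_fps q t ^ p) $ n =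
    (\<Sum>j\<in>{\<lceil>(real n - real p) / real (q + 1)\<rceil>..\<lfloor>(real n - real p) / real q\<rfloor>}.
       (- 1) ^ n * (- 1) ^ p * (- 1) powi (j * (int q + 1)) *
       (ibinom (int n - int q * j - 1) (int p - 1) * ibinom (int p) (int n - int q * j - j)) *
       (1 - t) ^ nat j)"
    (is "_ = sum ?f ?J")
proof -
  define d where "d = n - p"
  have n: "n = p + d" using assms by (simp add: d_def)
  \<comment> \<open>The ceiling bound expresses \<open>a \<ge> 0\<close> and the floor bound
    \<open>b \<ge> 0\<close>.\<close>
  have J: "j \<in> ?J \<longleftrightarrow> int d \<le> (int q + 1) * j \<and> int q * j \<le> int d" for j
  proof -
    have "\<lceil>(real n - real p) / real (q + 1)\<rceil> \<le> j \<longleftrightarrow> real_of_int (int d) \<le> real_of_int ((int q + 1) * j)"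
      by (simp add: n ceiling_le_iff divide_le_eq mult.commute add.commute add_pos_nonneg)
    moreover have "j \<le> \<lfloor>(real n - real p) / real q\<rfloor> \<longleftrightarrow> real_of_int (int q * j) \<le> real_of_int (int d)"
      using assms by (simp add: n le_floor_iff le_divide_eq mult.commute)
    ultimately show ?thesis by (simp only: of_int_le_iff atLeastAtMost_iff)
  qed
  define A where "A = {a\<in>{..p}. q * a \<le> d \<and> Suc q dvd d - q * a}"
  \<comment> \<open>The extra condition is \<open>a \<le> p\<close>. For the other \<open>j\<close>
    in the range, \<open>n - q * j - j = p - a\<close> is negative, so the second
    \<open>ibinom\<close> vanishes and the full range is restored at the end.\<close>
  define J' where "J' = {j\<in>?J. (int q + 1) * j \<le> int n}"
  define g where "g = (\<lambda>a. real (p choose a) * (t - 1) ^ a *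
       (real ((p + (d - q * a) div Suc q - 1) choose ((d - q * a) div Suc q)) *
        (1 - t) ^ ((d - q * a) div Suc q)))"
  have AE: "\<exists>b. d = q * a + Suc q * b \<and> (d - q * a) div Suc q = b" if "a \<in> A" for a
  proof -
    from that obtain b where "d - q * a = Suc q * b" "q * a \<le> d" unfolding A_def by (auto elim: dvdE)
    then show ?thesis by (intro exI[of _ b]) (simp del: mult_Suc)
  qed
  have J'E: "\<exists>a b. j = int (a + b) \<and> d = q * a + Suc q * b \<and> a \<le> p" if "j \<in> J'" for j
  proof -
    have j: "int d \<le> (int q + 1) * j" "int q * j \<le> int d" "(int q + 1) * j \<le> int n"
      using that J by (auto simp: J'_def)
    define a b where "a = nat ((int q + 1) * j - int d)" and "b = nat (int d - int q * j)"
    have ab: "int a = (int q + 1) * j - int d" "int b = int d - int q * j"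
      using j by (simp_all add: a_def b_def)
    have j_eq: "j = int (a + b)" using ab by (simp add: algebra_simps)
    have "int d = int q * j + int b" using ab(2) by simp
    then have "int d = int (q * a + Suc q * b)" unfolding j_eq by (simp add: algebra_simps)
    then have "d = q * a + Suc q * b" by (simp only: of_nat_eq_iff)
    moreover have "a \<le> p" using ab(1) j(3) n by simp
    ultimately show ?thesis using j_eq by blast
  qed
  have shift: "p + q * a \<le> n \<longleftrightarrow> q * a \<le> d" "n - (p + q * a) = d - q * a" for a
    by (simp_all add: n)
  have "(block_fps q t ^ p) $ n = (\<Sum>a\<le>p. if q * a \<le> d \<and> Suc q dvd d - q * a then g a else 0)"
    unfolding block_fps_power_nth_expand[OF less_le_trans[OF zero_less_one assms(2)]] g_def shift ..
  also have "\<dots> = sum g A"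
    unfolding A_def by (rule sum.inter_filter[symmetric]) simp
  also have "\<dots> = sum ?f J'"
  proof (rule sum.reindex_bij_witness[where j = "\<lambda>a. int (a + (d - q * a) div Suc q)"
          and i = "\<lambda>j. nat ((int q + 1) * j - int d)"])
    fix a assume a: "a \<in> A"
    obtain b where b: "d = q * a + Suc q * b" "(d - q * a) div Suc q = b" using AE[OF a] by blast
    have "a \<le> p" using a by (simp add: A_def)
    have eq: "(int q + 1) * int (a + b) - int d = int a"
      by (simp add: b(1) algebra_simps)
    show "nat ((int q + 1) * int (a + (d - q * a) div Suc q) - int d) = a"
      unfolding b(2) eq by simp
    have "int (a + b) \<in> J'"
      unfolding J'_def J mem_Collect_eq using \<open>a \<le> p\<close> by (simp add: n b(1) algebra_simps)
    then show "int (a + (d - q * a) div Suc q) \<in> J'" unfolding b(2) .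
    have e1: "int n - int q * int (a + b) - 1 = int (p + b - 1)"
      using assms by (simp add: n b(1) algebra_simps of_nat_diff)
    have e2: "int n - int q * int (a + b) - int (a + b) = int (p - a)"
      using \<open>a \<le> p\<close> by (simp add: n b(1) algebra_simps of_nat_diff)
    have e3: "int p - 1 = int (p - 1)" using assms by simp
    have "int (a + b) * (int q + 1) = int ((a + b) * (q + 1))"
      by (simp add: algebra_simps)
    then have "(- 1 :: real) powi (int (a + b) * (int q + 1)) = (- 1) ^ ((a + b) * (q + 1))"
      by (simp only: power_int_of_nat)
    also have "(a + b) * (q + 1) = a + d" by (simp add: b(1) algebra_simps)
    \<comment> \<open>Modulo 2, \<open>n + p\<close> equals \<open>d\<close>, while the last
      exponent is \<open>a + d\<close>. The remaining \<open>(- 1) ^ a\<close> is the sign that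
      turns \<open>(t - 1) ^ a\<close> into \<open>(1 - t) ^ a\<close>.\<close>
    finally have sgn: "(- 1 :: real) ^ n * (- 1) ^ p * (- 1) powi (int (a + b) * (int q + 1)) = (- 1) ^ a"
      by (simp add: n power_add mult_ac flip: power_mult_distrib)
    have c1: "(p + b - 1) choose (p - 1) = (p + b - 1) choose b"
      using assms by (subst binomial_symmetric) auto
    have c2: "p choose (p - a) = p choose a"
      using \<open>a \<le> p\<close> by (rule binomial_symmetric[symmetric])
    have pw: "(t - 1) ^ a = (- 1) ^ a * (1 - t) ^ a"
      by (simp flip: power_mult_distrib)
    show "?f (int (a + (d - q * a) div Suc q)) = g a"
      unfolding b(2) g_def sgn e1 e2 e3 ibinom_of_nat c1 c2 nat_int pw
      by (simp add: power_add mult_ac)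
  next
    fix j assume j: "j \<in> J'"
    obtain a b where ab: "j = int (a + b)" "d = q * a + Suc q * b" "a \<le> p" using J'E[OF j] by blast
    have eq: "(int q + 1) * int (a + b) - int d = int a"
      by (simp add: ab(2) algebra_simps)
    have dv: "d - q * a = Suc q * b" using ab(2) by simp
    then have dv': "(d - q * a) div Suc q = b" by (simp del: mult_Suc)
    show "int (nat ((int q + 1) * j - int d) + (d - q * nat ((int q + 1) * j - int d)) div Suc q) = j"
      unfolding ab(1) eq nat_int dv' ..
    have "a \<in> A" unfolding A_def using ab dv by (simp del: mult_Suc)
    then show "nat ((int q + 1) * j - int d) \<in> A" unfolding ab(1) eq nat_int .
  qed
  also have "\<dots> = sum ?f ?J"
  proof (rule sum.mono_neutral_left)
    show "\<forall>j\<in>?J - J'. ?f j = 0"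
      by (auto simp: J'_def ibinom_def algebra_simps)
  qed (auto simp: J'_def)
  finally show ?thesis .
qed

section \<open>From the generating polynomial to the count\<close>

text \<open>The monomial shifts degrees by \<open>a\<close>; what remains is an alternating partial
  sum of binomial coefficients, which telescopes by Pascal's rule. For \<open>b = 0\<close> the
  upper entry is -1, hence \<open>gchoose\<close>.\<close>

lemma sum_coeff_monom_mult_power:
  "(\<Sum>s\<le>m. coeff (monom 1 a * [:1, -1:] ^ b) s) =
    (if m < a then 0 else (- 1) ^ (m - a) * ((real b - 1) gchoose (m - a)))"
proof (cases "m < a")
  case True
  then show ?thesis by (simp add: coeff_monom_mult)
next
  case False
  have "(\<Sum>s\<le>m. coeff (monom 1 a * [:1, -1:] ^ b :: real poly) s) =
      (\<Sum>s\<in>{a..m}. coeff ([:1, -1:] ^ b) (s - a))"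
    by (rule sum.mono_neutral_cong_right) (auto simp: coeff_monom_mult)
  also have "\<dots> = (\<Sum>s\<le>m - a. coeff ([:1, -1:] ^ b) s)"
    by (rule sum.reindex_bij_witness[where i = "\<lambda>s. s + a" and j = "\<lambda>s. s - a"]) (use False in auto)
  also have "\<dots> = (\<Sum>s\<le>m - a. (real b gchoose s) * (- 1) ^ s)"
  proof (rule sum.cong[OF refl])
    fix s show "coeff ([:1, -1:] ^ b) s = (real b gchoose s) * (- 1) ^ s"
    proof (cases "s \<le> b")
      case False
      then have "degree ([:1, -1:] ^ b :: real poly) < s"
        using degree_power_le[of "[:1, -1:] :: real poly" b] by simp
      then show ?thesis using False by (simp add: coeff_eq_0 binomial_gbinomial[symmetric])
    qed (simp add: coeff_linear_poly_power binomial_gbinomial[symmetric])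
  qed
  also have "\<dots> = (- 1) ^ (m - a) * ((real b - 1) gchoose (m - a))"
    by (rule gbinomial_sum_lower_neg)
  finally show ?thesis using False by simp
qed

text \<open>An identity for all real \<open>t\<close> is an identity of polynomials, so coefficients
  may be compared. On the left, those of degree at most \<open>m\<close> add up to the desired
  count.\<close>

lemma card_le_from_generating_polynomial:
  fixes c :: "'i \<Rightarrow> real" and L :: "'w \<Rightarrow> nat"
  assumes "finite S" "finite I"
    and gf: "\<And>t. (\<Sum>w\<in>S. t ^ L w) = (\<Sum>i\<in>I. c i * (t ^ a i * (1 - t) ^ b i))"
  shows "real (card {w\<in>S. L w \<le> m}) =
    (\<Sum>i\<in>I. c i * (if m < a i then 0 else (- 1) ^ (m - a i) * ((real (b i) - 1) gchoose (m - a i))))"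
proof -
  have "poly (\<Sum>w\<in>S. monom 1 (L w)) = poly (\<Sum>i\<in>I. smult (c i) (monom 1 (a i) * [:1, -1:] ^ b i))"
    using gf by (simp add: fun_eq_iff poly_sum poly_monom)
  then have eq: "(\<Sum>w\<in>S. monom 1 (L w)) = (\<Sum>i\<in>I. smult (c i) (monom 1 (a i) * [:1, -1:] ^ b i))"
    by (simp add: poly_eq_poly_eq_iff)
  have "real (card {w\<in>S. L w \<le> m}) = (\<Sum>w\<in>S. if L w \<le> m then 1 else 0)"
    using assms(1) by (simp add: sum.If_cases Int_def)
  also have "\<dots> = (\<Sum>w\<in>S. \<Sum>s\<le>m. coeff (monom 1 (L w)) s)"
    by simp
  also have "\<dots> = (\<Sum>s\<le>m. coeff (\<Sum>w\<in>S. monom 1 (L w)) s)"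
    unfolding coeff_sum by (rule sum.swap)
  also have "\<dots> = (\<Sum>i\<in>I. c i * (\<Sum>s\<le>m. coeff (monom 1 (a i) * [:1, -1:] ^ b i) s))"
    unfolding eq coeff_sum by (subst sum.swap) (simp add: sum_distrib_left)
  finally show ?thesis by (simp only: sum_coeff_monom_mult_power)
qed

text \<open>Trims the common range of the \<open>p i\<close>: for \<open>p i = 0\<close> the power
  is 1, with coefficient 0 at \<open>n i \<ge> 1\<close>, and for \<open>p i > n i\<close> the power
  of \<open>B\<close> starts beyond \<open>n i\<close>.\<close>

lemma sum_run_weight_positive:
  fixes B V :: "real fps"
  assumes "V $ 0 = 1" "B * V = V - 1" and pos: "\<forall>i\<in>{1..k}. n i \<ge> 1"
  shows "(\<Sum>w\<in>words k n. run_weight V w) =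
    (\<Sum>p\<in>(\<Pi>\<^sub>E i\<in>{1..k}. {1..n i}). multinom k p * (\<Prod>i\<in>{1..k}. (B ^ p i) $ n i))"
proof -
  define M where "M = (\<Sum>i\<in>{1..k}. n i)"
  have M: "\<forall>i\<in>{1..k}. n i \<le> M" unfolding M_def by (auto intro!: member_le_sum)
  have B0: "B $ 0 = 0"
    using arg_cong[OF assms(2), of "\<lambda>f. f $ 0"] assms(1) by simp
  have "(\<Prod>i\<in>{1..k}. (B ^ p i) $ n i) = 0"
    if p: "p \<in> (\<Pi>\<^sub>E i\<in>{1..k}. {..M}) - (\<Pi>\<^sub>E i\<in>{1..k}. {1..n i})" for p
  proof -
    obtain i where i: "i \<in> {1..k}" "p i < 1 \<or> n i < p i"
      using p by (fastforce simp: PiE_iff not_le)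
    from i(2) have "(B ^ p i) $ n i = 0"
    proof
      assume "p i < 1"
      moreover have "1 \<le> n i" using pos i(1) by blast
      ultimately show ?thesis by simp
    next
      assume "n i < p i"
      then show ?thesis by (rule startsby_zero_power_prefix[OF B0, rule_format])
    qed
    then show ?thesis using i by (intro prod_zero) auto
  qed
  then show ?thesis
    unfolding sum_run_weight[OF assms(1,2) M] using M
    by (intro sum.mono_neutral_right finite_PiE PiE_mono) auto
qed

lemma sum_words_threshold:
  assumes "\<forall>i\<in>{1..k}. n i \<ge> 1"
  shows "(\<Sum>w\<in>words k n. t ^ length (filter (\<lambda>r. q < length r) (runs w))) =
    (\<Sum>p\<in>(\<Pi>\<^sub>E i\<in>{1..k}. {1..n i}). multinom k p * (\<Prod>i\<in>{1..k}. (block_fps q t ^ p i) $ n i))"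
  using sum_run_weight_positive[OF _ threshold_block_fps assms, of q t]
  by (simp add: run_weight_threshold_fps) (simp add: threshold_fps_def)

section \<open>The explicit formulas for positive and zero threshold\<close>

lemma Q_eq_card_runs:
  "Q k n q m = card {w\<in>words k n. length (filter (\<lambda>r. q < length r) (runs w)) \<le> m}"
  by (simp add: Q_def run_length_le_iff)

lemma prod_power_int:
  fixes x :: "'a :: field"
  assumes "x \<noteq> 0"
  shows "(\<Prod>i\<in>A. x powi f i) = x powi (\<Sum>i\<in>A. f i)"
  by (induction A rule: infinite_finite_induct) (simp_all add: assms power_int_add)

text \<open>Here only powers of \<open>1 - t\<close> occur, letter \<open>i\<close> contributing the
  exponent \<open>j i\<close>. The coefficients are therefore extracted with
  \<open>t\<close>-exponent 0 and with the sum of the \<open>j i\<close> as exponent of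
  \<open>1 - t\<close>, which produces the sign \<open>(- 1) ^ m\<close> and the binomial with lower
  entry \<open>m\<close>.\<close>

lemma Q_positive_threshold:
  assumes pos: "\<forall>i\<in>{1..k}. n i \<ge> 1" and "q > 0"
  shows "real (Q k n q m) =
         (- 1) ^ ((\<Sum>i\<in>{1..k}. n i) + m) *
         (\<Sum>p \<in> (\<Pi>\<^sub>E i\<in>{1..k}. {1..n i}).
            (- 1) ^ (\<Sum>i\<in>{1..k}. p i) * multinom k p *
            (\<Sum>j \<in> (\<Pi>\<^sub>E i\<in>{1..k}. {\<lceil>(real (n i) - real (p i)) / real (q + 1)\<rceil> ..
                                      \<lfloor>(real (n i) - real (p i)) / real q\<rfloor>}).
               (- 1) powi ((\<Sum>i\<in>{1..k}. j i) * (int q + 1)) *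
               ibinom ((\<Sum>i\<in>{1..k}. j i) - 1) (int m) *
               (\<Prod>i\<in>{1..k}.
                  ibinom (int (n i) - int q * j i - 1) (int (p i) - 1) *
                  ibinom (int (p i)) (int (n i) - int q * j i - j i))))"
proof -
  define P where "P = (\<Pi>\<^sub>E i\<in>{1..k}. {1..n i})"
  define J where "J = (\<lambda>p i. {\<lceil>(real (n i) - real (p i :: nat)) / real (q + 1)\<rceil> ..
                                      \<lfloor>(real (n i) - real (p i)) / real q\<rfloor>})"
  define g where "g = (\<lambda>p j i. ibinom (int (n i) - int q * j i - 1) (int (p i) - 1) *
                  ibinom (int (p i)) (int (n i) - int q * j i - j i))"
  define N where "N = (\<Sum>i\<in>{1..k}. n i)"
  define I where "I = (SIGMA p:P. (\<Pi>\<^sub>E i\<in>{1..k}. J p i))"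
  define c where "c = (\<lambda>p j. multinom k p * ((- 1) ^ N * (- 1) ^ (\<Sum>i\<in>{1..k}. p i) *
      (- 1) powi ((\<Sum>i\<in>{1..k}. j i) * (int q + 1)) * (\<Prod>i\<in>{1..k}. g p j i)))"
  have finP: "finite P" unfolding P_def by (intro finite_PiE) auto
  have finJ: "finite (\<Pi>\<^sub>E i\<in>{1..k}. J p i)" for p unfolding J_def by (intro finite_PiE) auto
  have finI: "finite I" unfolding I_def using finP finJ by auto
  have block: "(\<Prod>i\<in>{1..k}. (block_fps q t ^ p i) $ n i) =
      (\<Sum>j\<in>(\<Pi>\<^sub>E i\<in>{1..k}. J p i). (- 1) ^ N * (- 1) ^ (\<Sum>i\<in>{1..k}. p i) *
      (- 1) powi ((\<Sum>i\<in>{1..k}. j i) * (int q + 1)) * (\<Prod>i\<in>{1..k}. g p j i) *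
      (1 - t) ^ (\<Sum>i\<in>{1..k}. nat (j i)))" if p: "p \<in> P" for p t
  proof -
    have "(\<Prod>i\<in>{1..k}. (block_fps q t ^ p i) $ n i) = (\<Prod>i\<in>{1..k}. \<Sum>j\<in>J p i.
       (- 1) ^ n i * (- 1) ^ p i * (- 1) powi (j * (int q + 1)) *
       (ibinom (int (n i) - int q * j - 1) (int (p i) - 1) * ibinom (int (p i)) (int (n i) - int q * j - j)) *
       (1 - t) ^ nat j)"
      unfolding J_def
    proof (rule prod.cong[OF refl], rule block_fps_power_nth[OF \<open>q > 0\<close>])
      fix i assume "i \<in> {1..k}"
      then have "p i \<in> {1..n i}" using p unfolding P_def by (rule PiE_mem[rotated])
      then show "1 \<le> p i" "p i \<le> n i" by auto
    qed
    also have "\<dots> = (\<Sum>j\<in>(\<Pi>\<^sub>E i\<in>{1..k}. J p i). \<Prod>i\<in>{1..k}.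
       (- 1) ^ n i * (- 1) ^ p i * (- 1) powi (j i * (int q + 1)) * g p j i * (1 - t) ^ nat (j i))"
      unfolding g_def by (rule prod_sum_PiE) (auto simp: J_def)
    finally show ?thesis
      by (simp add: prod.distrib power_sum prod_power_int sum_distrib_right N_def)
  qed
  have gf: "(\<Sum>w\<in>words k n. t ^ length (filter (\<lambda>r. q < length r) (runs w))) =
      (\<Sum>x\<in>I. (case x of (p, j) \<Rightarrow> c p j) * (t ^ 0 * (1 - t) ^ (case x of (p, j) \<Rightarrow> \<Sum>i\<in>{1..k}. nat (j i))))" for t
  proof -
    have "(\<Sum>w\<in>words k n. t ^ length (filter (\<lambda>r. q < length r) (runs w))) =
        (\<Sum>p\<in>P. \<Sum>j\<in>(\<Pi>\<^sub>E i\<in>{1..k}. J p i). c p j * (1 - t) ^ (\<Sum>i\<in>{1..k}. nat (j i)))"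
      unfolding sum_words_threshold[OF pos] P_def[symmetric] c_def
      by (intro sum.cong refl) (simp only: block sum_distrib_left mult.assoc)
    also have "\<dots> = (\<Sum>(p, j)\<in>I. c p j * (1 - t) ^ (\<Sum>i\<in>{1..k}. nat (j i)))"
      unfolding I_def using finP finJ by (intro sum.Sigma) auto
    finally show ?thesis by (simp add: case_prod_unfold)
  qed
  have "real (Q k n q m) = (\<Sum>x\<in>I. (case x of (p, j) \<Rightarrow> c p j) *
      ((- 1) ^ m * ((real (case x of (p, j) \<Rightarrow> \<Sum>i\<in>{1..k}. nat (j i)) - 1) gchoose m)))"
    unfolding Q_eq_card_runs card_le_from_generating_polynomial[OF finite_words finI gf] by simp
  also have "\<dots> = (\<Sum>p\<in>P. \<Sum>j\<in>(\<Pi>\<^sub>E i\<in>{1..k}. J p i).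
      c p j * ((- 1) ^ m * ((real (\<Sum>i\<in>{1..k}. nat (j i)) - 1) gchoose m)))"
    unfolding I_def using finP finJ by (subst sum.Sigma) (auto simp: case_prod_unfold)
  also have "\<dots> = (\<Sum>p\<in>P. \<Sum>j\<in>(\<Pi>\<^sub>E i\<in>{1..k}. J p i).
      c p j * ((- 1) ^ m * ibinom ((\<Sum>i\<in>{1..k}. j i) - 1) (int m)))"
  proof (intro sum.cong refl)
    fix p j assume p: "p \<in> P" and j: "j \<in> (\<Pi>\<^sub>E i\<in>{1..k}. J p i)"
    \<comment> \<open>Since \<open>p i \<le> n i\<close>, the ceiling is nonnegative and
      \<open>nat\<close> loses nothing. If all \<open>j i\<close> are 0, the upper entry becomes -1,
      which \<open>gchoose\<close> and \<open>ibinom\<close> treat alike.\<close>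
    have "int (nat (j i)) = j i" if i: "i \<in> {1..k}" for i
    proof -
      have "p i \<in> {1..n i}" using p i unfolding P_def by (rule PiE_mem)
      then have "0 \<le> (real (n i) - real (p i)) / real (q + 1)" by simp
      then have "0 \<le> \<lceil>(real (n i) - real (p i)) / real (q + 1)\<rceil>" by linarith
      also have "\<dots> \<le> j i" using PiE_mem[OF j i] by (simp add: J_def)
      finally show ?thesis by simp
    qed
    then have "int (\<Sum>i\<in>{1..k}. nat (j i)) = (\<Sum>i\<in>{1..k}. j i)" by simp
    then have "real (\<Sum>i\<in>{1..k}. nat (j i)) = real_of_int (\<Sum>i\<in>{1..k}. j i)"
      by (metis of_int_of_nat_eq)
    then show "c p j * ((- 1) ^ m * ((real (\<Sum>i\<in>{1..k}. nat (j i)) - 1) gchoose m)) =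
        c p j * ((- 1) ^ m * ibinom ((\<Sum>i\<in>{1..k}. j i) - 1) (int m))"
      by (simp add: ibinom_def)
  qed
  also have "\<dots> = (- 1) ^ (N + m) * (\<Sum>p\<in>P. (- 1) ^ (\<Sum>i\<in>{1..k}. p i) * multinom k p *
      (\<Sum>j\<in>(\<Pi>\<^sub>E i\<in>{1..k}. J p i). (- 1) powi ((\<Sum>i\<in>{1..k}. j i) * (int q + 1)) *
        ibinom ((\<Sum>i\<in>{1..k}. j i) - 1) (int m) * (\<Prod>i\<in>{1..k}. g p j i)))"
    by (simp add: c_def sum_distrib_left power_add mult_ac)
  finally show ?thesis by (simp only: P_def J_def g_def N_def)
qed

text \<open>With threshold 0 every run is long, and letter \<open>i\<close> contributes
  \<open>t ^ p i * (1 - t) ^ (n i - p i)\<close>. With \<open>s\<close> the sum of the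
  \<open>p i\<close>, the exponents entering the extraction are \<open>s\<close> for
  \<open>t\<close> and \<open>N - s\<close> for \<open>1 - t\<close>.\<close>

lemma Q_zero_threshold:
  assumes pos: "\<forall>i\<in>{1..k}. n i \<ge> 1" and N: "N = (\<Sum>i\<in>{1..k}. n i)"
  shows "real (Q k n 0 m) =
         (- 1) ^ m *
         (\<Sum>p \<in> (\<Pi>\<^sub>E i\<in>{1..k}. {1..n i}).
            (- 1) ^ (\<Sum>i\<in>{1..k}. p i) *
            ibinom (int N - int (\<Sum>i\<in>{1..k}. p i) - 1) (int m - int (\<Sum>i\<in>{1..k}. p i)) *
            multinom k p *
            (\<Prod>i\<in>{1..k}. ibinom (int (n i) - 1) (int (p i) - 1)))"
proof -
  define P where "P = (\<Pi>\<^sub>E i\<in>{1..k}. {1..n i})"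
  have finP: "finite P" unfolding P_def by (intro finite_PiE) auto
  have p: "1 \<le> p i" "p i \<le> n i" if "p \<in> P" "i \<in> {1..k}" for p i
    using PiE_mem[OF that[unfolded P_def]] by auto
  define c where "c = (\<lambda>p. multinom k p * (\<Prod>i\<in>{1..k}. ibinom (int (n i) - 1) (int (p i) - 1)))"
  have gf: "(\<Sum>w\<in>words k n. t ^ length (filter (\<lambda>r. 0 < length r) (runs w))) =
      (\<Sum>p\<in>P. c p * (t ^ (\<Sum>i\<in>{1..k}. p i) * (1 - t) ^ (N - (\<Sum>i\<in>{1..k}. p i))))" for t
    unfolding sum_words_threshold[OF pos] P_def[symmetric]
  proof (rule sum.cong[OF refl])
    fix p' assume p': "p' \<in> P"
    have "(\<Prod>i\<in>{1..k}. (block_fps 0 t ^ p' i) $ n i) = (\<Prod>i\<in>{1..k}.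
        ibinom (int (n i) - 1) (int (p' i) - 1) * t ^ p' i * (1 - t) ^ (n i - p' i))"
    proof (rule prod.cong[OF refl])
      fix i assume "i \<in> {1..k}"
      note b = p[OF p' this]
      then have "int (n i) - 1 = int (n i - 1)" "int (p' i) - 1 = int (p' i - 1)" by auto
      then show "(block_fps 0 t ^ p' i) $ n i =
          ibinom (int (n i) - 1) (int (p' i) - 1) * t ^ p' i * (1 - t) ^ (n i - p' i)"
        by (simp only: ibinom_of_nat block_fps_0_power_nth[OF b])
    qed
    also have "\<dots> = (\<Prod>i\<in>{1..k}. ibinom (int (n i) - 1) (int (p' i) - 1)) *
        (t ^ (\<Sum>i\<in>{1..k}. p' i) * (1 - t) ^ (\<Sum>i\<in>{1..k}. n i - p' i))"
      by (simp add: prod.distrib power_sum)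
    also have "(\<Sum>i\<in>{1..k}. n i - p' i) = N - (\<Sum>i\<in>{1..k}. p' i)"
      unfolding N by (rule sum_subtractf_nat) (use p p' in auto)
    finally show "multinom k p' * (\<Prod>i\<in>{1..k}. (block_fps 0 t ^ p' i) $ n i) =
        c p' * (t ^ (\<Sum>i\<in>{1..k}. p' i) * (1 - t) ^ (N - (\<Sum>i\<in>{1..k}. p' i)))"
      by (simp add: c_def)
  qed
  have "real (Q k n 0 m) = (\<Sum>p\<in>P. c p * (if m < (\<Sum>i\<in>{1..k}. p i) then 0 else
      (- 1) ^ (m - (\<Sum>i\<in>{1..k}. p i)) *
      ((real (N - (\<Sum>i\<in>{1..k}. p i)) - 1) gchoose (m - (\<Sum>i\<in>{1..k}. p i)))))"
    unfolding Q_eq_card_runs by (rule card_le_from_generating_polynomial[OF finite_words finP gf])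
  also have "\<dots> = (\<Sum>p\<in>P. (- 1) ^ m * ((- 1) ^ (\<Sum>i\<in>{1..k}. p i) *
            ibinom (int N - int (\<Sum>i\<in>{1..k}. p i) - 1) (int m - int (\<Sum>i\<in>{1..k}. p i)) * c p))"
  proof (rule sum.cong[OF refl])
    fix p' assume p': "p' \<in> P"
    define s where "s = (\<Sum>i\<in>{1..k}. p' i)"
    have "s \<le> N" unfolding s_def N by (rule sum_mono) (use p p' in auto)
    show "c p' * (if m < s then 0 else (- 1) ^ (m - s) * ((real (N - s) - 1) gchoose (m - s))) =
        (- 1) ^ m * ((- 1) ^ s * ibinom (int N - int s - 1) (int m - int s) * c p')"
    \<comment> \<open>For \<open>m < s\<close> the contribution 0 agrees with \<open>ibinom\<close>
      at a negative lower entry; otherwise \<open>m - s\<close> and \<open>m + s\<close> have the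
      same parity.\<close>
    proof (cases "m < s")
      case False
      then obtain d where d: "m = s + d" by (metis le_add_diff_inverse not_less)
      have "(- 1 :: real) ^ m * (- 1) ^ s = (- 1) ^ d"
        by (simp add: d power_add flip: power_mult_distrib)
      then show ?thesis using \<open>s \<le> N\<close> by (simp add: d ibinom_def of_nat_diff flip: mult.assoc)
    qed (simp add: ibinom_def)
  qed
  finally show ?thesis
    unfolding P_def[symmetric] c_def by (simp add: sum_distrib_left mult_ac)
qed

section \<open>The count without restriction\<close>

lemma length_runs_le: "length (runs w) \<le> length w"
proof (induction w rule: runs.induct)
  case (2 x xs)
  then show ?case using length_dropWhile_le[of "\<lambda>y. y = x" xs] by simp
qed simp

text \<open>At \<open>t = 1\<close> every word has weight 1 and \<open>block_fps 0 1\<close> is just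
  \<open>fps_X\<close>: all blocks have length one, so only the tuple \<open>p = n\<close>
  survives.\<close>

lemma card_words:
  assumes pos: "\<forall>i\<in>{1..k}. n i \<ge> 1"
  shows "real (card (words k n)) = multinom k n"
proof -
  define P where "P = (\<Pi>\<^sub>E i\<in>{1..k}. {1..n i})"
  have finP: "finite P" unfolding P_def by (intro finite_PiE) auto
  have "real (card (words k n)) =
      (\<Sum>p\<in>P. multinom k p * (\<Prod>i\<in>{1..k}. (block_fps 0 1 ^ p i) $ n i))"
    using sum_words_threshold[OF pos, of 1 0] by (simp add: P_def)
  \<comment> \<open>The tuples in \<open>P\<close> are extensional, so the surviving one is
    \<open>n\<close> restricted to \<open>{1..k}\<close>.\<close>
  also have "\<dots> = (\<Sum>p\<in>P. if p = restrict n {1..k} then multinom k n else 0)"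
  proof (rule sum.cong[OF refl])
    fix p assume p: "p \<in> P"
    have b: "(block_fps 0 1 ^ p i) $ n i = (if p i = n i then 1 else 0)" if "i \<in> {1..k}" for i
      using PiE_mem[OF p[unfolded P_def] that] by (auto simp: block_fps_0_power_nth)
    show "multinom k p * (\<Prod>i\<in>{1..k}. (block_fps 0 1 ^ p i) $ n i) =
        (if p = restrict n {1..k} then multinom k n else 0)"
    proof (cases "\<forall>i\<in>{1..k}. p i = n i")
      case True
      then have "p = restrict n {1..k}"
        using p by (auto simp: P_def PiE_iff extensional_def fun_eq_iff)
      moreover have "multinom k p = multinom k n" using True by (intro multinom_cong) auto
      ultimately show ?thesis using True b by simp
    next
      case False
      then obtain i where "i \<in> {1..k}" "p i \<noteq> n i" by blast
      then have "(\<Prod>i\<in>{1..k}. (block_fps 0 1 ^ p i) $ n i) = 0" "p \<noteq> restrict n {1..k}"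
        using b[of i] by (auto intro!: prod_zero)
      then show ?thesis by simp
    qed
  qed
  also have "\<dots> = multinom k n"
    using finP pos by (simp add: P_def)
  finally show ?thesis .
qed

text \<open>A word has at most as many runs as letters, so the bound \<open>m\<close> on the number
  of long runs excludes nothing.\<close>

lemma Q_unrestricted:
  assumes "(\<Sum>i\<in>{1..k}. n i) \<le> m"
  shows "Q k n q m = card (words k n)"
proof -
  have "length (filter (\<lambda>r. q < length r) (runs w)) \<le> m" if w: "w \<in> words k n" for w
  proof -
    have "length w = (\<Sum>i\<in>{1..k}. count_list w i)"
      using w by (intro sum_count_set[symmetric]) (auto simp: words_def)
    also have "\<dots> = (\<Sum>i\<in>{1..k}. n i)"
      using w by (intro sum.cong) (auto simp: words_def)
    finally have "length w \<le> m" using assms by simp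
    then show ?thesis
      by (meson length_filter_le length_runs_le order_trans)
  qed
  then have "{w\<in>words k n. length (filter (\<lambda>r. q < length r) (runs w)) \<le> m} = words k n" by blast
  then show ?thesis by (simp add: Q_eq_card_runs)
qed

theorem theorem3:
  fixes k q m N :: nat and n :: "nat \<Rightarrow> nat"
  assumes "k \<ge> 1"
    and "\<forall>i\<in>{1..k}. n i \<ge> 1"
    and "N = (\<Sum>i\<in>{1..k}. n i)"
  shows
    "(q > 0 \<longrightarrow>
       real (Q k n q m) =
         (- 1) ^ (N + m) *
         (\<Sum>p \<in> (\<Pi>\<^sub>E i\<in>{1..k}. {1..n i}).
            (- 1) ^ (\<Sum>i\<in>{1..k}. p i) * multinom k p *
            (\<Sum>j \<in> (\<Pi>\<^sub>E i\<in>{1..k}. {\<lceil>(real (n i) - real (p i)) / real (q + 1)\<rceil> ..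
                                      \<lfloor>(real (n i) - real (p i)) / real q\<rfloor>}).
               (- 1) powi ((\<Sum>i\<in>{1..k}. j i) * (int q + 1)) *
               ibinom ((\<Sum>i\<in>{1..k}. j i) - 1) (int m) *
               (\<Prod>i\<in>{1..k}.
                  ibinom (int (n i) - int q * j i - 1) (int (p i) - 1) *
                  ibinom (int (p i)) (int (n i) - int q * j i - j i))))) \<and>
     (q = 0 \<and> m \<ge> N \<longrightarrow> real (Q k n q m) = multinom k n) \<and>
     (q = 0 \<and> m < N \<longrightarrow>
       real (Q k n q m) =
         (- 1) ^ m *
         (\<Sum>p \<in> (\<Pi>\<^sub>E i\<in>{1..k}. {1..n i}).
            (- 1) ^ (\<Sum>i\<in>{1..k}. p i) *
            ibinom (int N - int (\<Sum>i\<in>{1..k}. p i) - 1) (int m - int (\<Sum>i\<in>{1..k}. p i)) *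
            multinom k p *
            (\<Prod>i\<in>{1..k}. ibinom (int (n i) - 1) (int (p i) - 1))))"
  using Q_positive_threshold[OF assms(2)] Q_zero_threshold[OF assms(2,3)]
    Q_unrestricted[where k = k and n = n and m = m and q = 0] card_words[OF assms(2)]
  unfolding assms(3) by simp

end
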